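(* Let $H$ be a br-graph with switching graph $\mathcal{P}_H$, and let $(\mathcal{P}_H)_R$ be the graph of red edges of $\mathcal{P}_H$. The following are equivalent: (1) $(\mathcal{P}_H)_R$ admits a conservative 3-NU polymorphism; (2) $\mathcal{P}_H$ admits a conservative WNU-polymorphism.
   Context: Graphs are undirected and may have loops. A br-graph is a pair of graphs (red edges and blue edges) on a common vertex set. The switching graph $\mathcal{P}_H$ has vertex set $V(H)\times\{1,2\}$; each red edge $uv$ of $H$ gives red edges $(u,1)(v,1)$, $(u,2)(v,2)$ and blue edges $(u,1)(v,2)$, $(u,2)(v,1)$, and each blue edge $uv$ of $H$ gives blue edges $(u,1)(v,1)$, $(u,2)(v,2)$ and red edges $(u,1)(v,2)$, $(u,2)(v,1)$. A $k$-ary polymorphism of a graph (resp. br-graph) $K$ is a map $\phi:V(K)^k\to V(K)$ mapping $k$-tuples of edges coordinatewise to an edge (resp. preserving red edges and preserving blue edges in this sense). It is conservative if $\phi(x_1,\dots,x_k)\in\{x_1,\dots,x_k\}$. A ternary polymorphism is 3-NU if $\phi(x,x,y)=\phi(x,y,x)=\phi(y,x,x)=x$ for all $x,y$. A polymorphism is WNU if it is idempotent and $\phi(x,\dots,x,y)=\phi(x,\dots,y,x)=\dots=\phi(y,x,\dots,x)$ for all $x,y$. *)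

theory Defs
  imports Main
begin

text \<open>
  An undirected graph, loops allowed, is given by its vertex set and its symmetric adjacency
  relation; a loop at \<open>v\<close> is the pair \<open>(v, v)\<close>.
\<close>

record 'v graph =
  verts :: "'v set"
  edges :: "('v \<times> 'v) set"

definition is_graph :: "'v graph \<Rightarrow> bool" where
  "is_graph G \<longleftrightarrow> edges G \<subseteq> verts G \<times> verts G \<and> sym (edges G)"

text \<open>The red and the blue edge sets of a br-graph need not be disjoint.\<close>

record 'v brgraph =
  br_verts :: "'v set"
  red :: "('v \<times> 'v) set"
  blue :: "('v \<times> 'v) set"

definition red_graph :: "'v brgraph \<Rightarrow> 'v graph" where
  "red_graph K = \<lparr>verts = br_verts K, edges = red K\<rparr>"

definition blue_graph :: "'v brgraph \<Rightarrow> 'v graph" where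
  "blue_graph K = \<lparr>verts = br_verts K, edges = blue K\<rparr>"

definition is_brgraph :: "'v brgraph \<Rightarrow> bool" where
  "is_brgraph K \<longleftrightarrow> is_graph (red_graph K) \<and> is_graph (blue_graph K)"

text \<open>
  Since \<open>red H\<close> and \<open>blue H\<close> contain both orientations of every edge, the sets
  below again contain both orientations of \<open>(u,1)(v,2)\<close> and of \<open>(u,2)(v,1)\<close>.
\<close>

definition switching_graph :: "'v brgraph \<Rightarrow> ('v \<times> nat) brgraph" where
  "switching_graph H =
    \<lparr>br_verts = br_verts H \<times> {1, 2},
     red = {((u, i), (v, j)) | u v i j. (u, v) \<in> red H \<and> (i, j) \<in> {(1, 1), (2, 2)}}
         \<union> {((u, i), (v, j)) | u v i j. (u, v) \<in> blue H \<and> (i, j) \<in> {(1, 2), (2, 1)}},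
     blue = {((u, i), (v, j)) | u v i j. (u, v) \<in> blue H \<and> (i, j) \<in> {(1, 1), (2, 2)}}
          \<union> {((u, i), (v, j)) | u v i j. (u, v) \<in> red H \<and> (i, j) \<in> {(1, 2), (2, 1)}}\<rparr>"

text \<open>
  We represent a \<open>k\<close>-ary operation on \<open>V\<close> by a function on lists; only its values on
  \<open>tuples k V\<close> matter.
\<close>

definition tuples :: "nat \<Rightarrow> 'v set \<Rightarrow> 'v list set" where
  "tuples k V = {xs. length xs = k \<and> set xs \<subseteq> V}"

definition polymorphism :: "nat \<Rightarrow> 'v graph \<Rightarrow> ('v list \<Rightarrow> 'v) \<Rightarrow> bool" where
  "polymorphism k G \<phi> \<longleftrightarrow>
    (\<forall>xs \<in> tuples k (verts G). \<phi> xs \<in> verts G) \<and>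
    (\<forall>xs \<in> tuples k (verts G). \<forall>ys \<in> tuples k (verts G).
      (\<forall>i<k. (xs ! i, ys ! i) \<in> edges G) \<longrightarrow> (\<phi> xs, \<phi> ys) \<in> edges G)"

definition br_polymorphism :: "nat \<Rightarrow> 'v brgraph \<Rightarrow> ('v list \<Rightarrow> 'v) \<Rightarrow> bool" where
  "br_polymorphism k K \<phi> \<longleftrightarrow>
    polymorphism k (red_graph K) \<phi> \<and> polymorphism k (blue_graph K) \<phi>"

definition conservative :: "nat \<Rightarrow> 'v set \<Rightarrow> ('v list \<Rightarrow> 'v) \<Rightarrow> bool" where
  "conservative k V \<phi> \<longleftrightarrow> (\<forall>xs \<in> tuples k V. \<phi> xs \<in> set xs)"

definition nu3 :: "'v set \<Rightarrow> ('v list \<Rightarrow> 'v) \<Rightarrow> bool" where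
  "nu3 V \<phi> \<longleftrightarrow>
    (\<forall>x \<in> V. \<forall>y \<in> V. \<phi> [x, x, y] = x \<and> \<phi> [x, y, x] = x \<and> \<phi> [y, x, x] = x)"

definition idempotent :: "nat \<Rightarrow> 'v set \<Rightarrow> ('v list \<Rightarrow> 'v) \<Rightarrow> bool" where
  "idempotent k V \<phi> \<longleftrightarrow> (\<forall>x \<in> V. \<phi> (replicate k x) = x)"

text \<open>
  The arity is at least 2, as usual for weak near unanimity: the unary identity would satisfy the
  identities vacuously.
\<close>

definition wnu :: "nat \<Rightarrow> 'v set \<Rightarrow> ('v list \<Rightarrow> 'v) \<Rightarrow> bool" where
  "wnu k V \<phi> \<longleftrightarrow>
    k \<ge> 2 \<and> idempotent k V \<phi> \<and>
    (\<forall>x \<in> V. \<forall>y \<in> V. \<forall>i<k. \<forall>j<k.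
      \<phi> ((replicate k x)[i := y]) = \<phi> ((replicate k x)[j := y]))"

end

theory Submission
  imports Defs
begin

text \<open>
  Call \<open>a\<close> separated from \<open>b, c\<close> if parallel walks from \<open>a, b, c\<close> make \<open>b\<close> and \<open>c\<close> meet while no
  vertex of the first walk is adjacent to the next vertex of one of the other two. A conservative
  3-NU polymorphism cannot select a separated coordinate, so it excludes triples in which each
  coordinate is separated from the other two. Conversely, without such asteroidal triples,
  selecting the first unseparated coordinate is a conservative 3-NU polymorphism. This operation is
  defined from the edge relation alone, so on the red graph of a switching graph it commutes with
  the automorphism exchanging \<open>(v, 1)\<close> and \<open>(v, 2)\<close>. As \<open>xy\<close> is blue if and only if \<open>x\<close> and the
  twin of \<open>y\<close> are joined by a red edge, it preserves the blue edges as well.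

  It remains to exclude asteroidal triples in the presence of a conservative WNU polymorphism. Its
  restrictions to pairs of vertices transfer along the separating walks, so that all pairs in an
  asteroidal triple carry the same self-dual Boolean function \<open>g\<close>. By the WNU identities \<open>g\<close> takes
  equal values on the three blocks of some partition of the arguments; the polymorphism, applied to
  the triple according to this partition, then has no possible value.
\<close>

section \<open>Separated coordinates and majority operations\<close>

text \<open>Nonadjacency is imposed only from the first walk to the next vertices of the other two,
  not in reverse. Backward inductions use it thus: a value adjacent to \<open>a\<close> can be
  neither \<open>b'\<close> nor \<open>c'\<close>.\<close>

inductive separated :: "('v \<times> 'v) set \<Rightarrow> 'v \<Rightarrow> 'v \<Rightarrow> 'v \<Rightarrow> bool" for E where
  base: "a \<noteq> b \<Longrightarrow> separated E a b b"
| step: "(a, a') \<in> E \<Longrightarrow> (b, b') \<in> E \<Longrightarrow> (c, c') \<in> E \<Longrightarrow> (a, b') \<notin> E \<Longrightarrow> (a, c') \<notin> E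
    \<Longrightarrow> separated E a' b' c' \<Longrightarrow> separated E a b c"

lemma separated_commute: "separated E a b c \<Longrightarrow> separated E a c b"
  by (induction rule: separated.induct) (auto intro: separated.intros)

lemma not_separated_self: "\<not> separated E a a b" "\<not> separated E a b a"
  by (auto elim: separated.cases)

lemma separated_stepE:
  assumes "separated E a b c" "b \<noteq> c"
  obtains a' b' c' where "(a, a') \<in> E" "(b, b') \<in> E" "(c, c') \<in> E" "(a, b') \<notin> E" "(a, c') \<notin> E"
    "separated E a' b' c'"
  using assms by (cases rule: separated.cases) auto

lemma separated_automorphism:
  assumes "separated E a b c" "inj s" "\<And>x y. (s x, s y) \<in> E \<longleftrightarrow> (x, y) \<in> E"
  shows "separated E (s a) (s b) (s c)"
  using assms(1)
proof (induction rule: separated.induct)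
  case (base a b)
  then show ?case using assms(2) by (auto intro!: separated.base dest: injD)
next
  case (step a a' b b' c c')
  then show ?case using assms(3) by (auto intro!: separated.step[of "s a" "s a'" E "s b" "s b'" "s c" "s c'"])
qed

definition asteroidal :: "('v \<times> 'v) set \<Rightarrow> 'v \<Rightarrow> 'v \<Rightarrow> 'v \<Rightarrow> bool" where
  "asteroidal E a b c \<longleftrightarrow> separated E a b c \<and> separated E b a c \<and> separated E c a b"

section \<open>Selecting the first unseparated coordinate\<close>

definition first_unseparated :: "('v \<times> 'v) set \<Rightarrow> 'v \<Rightarrow> 'v \<Rightarrow> 'v \<Rightarrow> 'v" where
  "first_unseparated E a b c =
    (if \<not> separated E a b c then a else if \<not> separated E b a c then b else c)"

lemma first_unseparated_nu:
  "first_unseparated E x x y = x" "first_unseparated E x y x = x" "first_unseparated E y x x = x"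
  by (auto simp: first_unseparated_def not_separated_self intro: separated.base)

text \<open>If \<open>b'\<close> were not adjacent to \<open>a\<close>, then \<open>c'\<close> would
  be, as otherwise the separation of \<open>a'\<close> would extend back to \<open>a\<close>. But
  then stepping from \<open>b'\<close>, \<open>a'\<close>, \<open>c'\<close> to \<open>b\<close>,
  \<open>a\<close>, \<open>a\<close> would separate \<open>b'\<close>.\<close>

lemma unseparated_adjacent:
  assumes "sym E" "(a, a') \<in> E" "(b, b') \<in> E" "(c, c') \<in> E"
    and "\<not> separated E a b c" "separated E a' b' c'" "\<not> separated E b' a' c'"
  shows "(a, b') \<in> E"
proof (rule ccontr)
  assume n: "(a, b') \<notin> E"
  have "(a, c') \<in> E"
    using separated.step[OF assms(2-4) n _ assms(6)] assms(5) by blast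
  then have "(c', a) \<in> E" "(a', a) \<in> E" "(b', b) \<in> E" "(b', a) \<notin> E"
    using assms(1-3) n by (auto dest: symD)
  moreover have "separated E b a a" using n assms(3) by (intro separated.base) auto
  ultimately show False
    using separated.step[of b' b E a' a c' a] assms(7) by blast
qed

text \<open>If the selected positions differ, the earlier one is unseparated in one triple and
  separated in the other, so \<open>unseparated_adjacent\<close> applies. Excluding asteroidal
  triples makes the default choice of the third position unseparated too.\<close>

lemma first_unseparated_polymorphism:
  assumes "sym E" "(a, a') \<in> E" "(b, b') \<in> E" "(c, c') \<in> E"
    and "\<not> asteroidal E a b c" "\<not> asteroidal E a' b' c'"
  shows "(first_unseparated E a b c, first_unseparated E a' b' c') \<in> E"
proof -
  have cm: "separated E x y z \<longleftrightarrow> separated E x z y" for x y z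
    using separated_commute by metis
  have flip: "(x, y) \<in> E" if "(y, x) \<in> E" for x y
    using assms(1) that by (rule symD)
  note adj = unseparated_adjacent[OF assms(1)]
  have "\<not> separated E a b c \<Longrightarrow> separated E a' b' c' \<Longrightarrow> \<not> separated E b' a' c' \<Longrightarrow> (a, b') \<in> E"
    and "\<not> separated E a b c \<Longrightarrow> separated E a' b' c' \<Longrightarrow> \<not> separated E c' a' b' \<Longrightarrow> (a, c') \<in> E"
    and "\<not> separated E b a c \<Longrightarrow> separated E b' a' c' \<Longrightarrow> \<not> separated E c' a' b' \<Longrightarrow> (b, c') \<in> E"
    using adj[of a a' b b' c c'] adj[of a a' c c' b b'] adj[of b b' c c' a a'] assms(2-4) cm
    by blast+
  moreover
  have "\<not> separated E a' b' c' \<Longrightarrow> separated E a b c \<Longrightarrow> \<not> separated E b a c \<Longrightarrow> (b, a') \<in> E"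
    and "\<not> separated E a' b' c' \<Longrightarrow> separated E a b c \<Longrightarrow> \<not> separated E c a b \<Longrightarrow> (c, a') \<in> E"
    and "\<not> separated E b' a' c' \<Longrightarrow> separated E b a c \<Longrightarrow> \<not> separated E c a b \<Longrightarrow> (c, b') \<in> E"
    using adj[of a' a b' b c' c] adj[of a' a c' c b' b] adj[of b' b c' c a' a] assms(2-4) cm flip
    by blast+
  ultimately show ?thesis
    using assms(2-) unfolding first_unseparated_def asteroidal_def by presburger
qed

text \<open>Induction backwards from the meeting point, where near unanimity decides. Before it, the
  value at the next triple is \<open>b'\<close> or \<open>c'\<close>, hence not adjacent to
  \<open>a\<close>.\<close>

lemma separated_not_selected:
  assumes sep: "separated E a b c" and sub: "E \<subseteq> V \<times> V" and V: "a \<in> V" "b \<in> V" "c \<in> V"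
    and cons: "\<And>x y z. x \<in> V \<Longrightarrow> y \<in> V \<Longrightarrow> z \<in> V \<Longrightarrow> m x y z \<in> {x, y, z}"
    and nu: "\<And>x y. x \<in> V \<Longrightarrow> y \<in> V \<Longrightarrow> m x y y = y"
    and pol: "\<And>x y z x' y' z'. (x, x') \<in> E \<Longrightarrow> (y, y') \<in> E \<Longrightarrow> (z, z') \<in> E
      \<Longrightarrow> (m x y z, m x' y' z') \<in> E"
  shows "m a b c \<noteq> a"
  using sep V
proof (induction rule: separated.induct)
  case (base a b)
  then show ?case using nu by auto
next
  case (step a a' b b' c c')
  then have "a' \<in> V" "b' \<in> V" "c' \<in> V" using sub by auto
  then have "m a' b' c' \<noteq> a'" "m a' b' c' \<in> {a', b', c'}" using step cons by auto
  moreover have "(m a b c, m a' b' c') \<in> E" using step pol by blast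
  ultimately show ?case using step by auto
qed

lemma tuples_3: "[a, b, c] \<in> tuples 3 V \<longleftrightarrow> a \<in> V \<and> b \<in> V \<and> c \<in> V"
  by (auto simp: tuples_def)

lemma tuples_3E:
  assumes "xs \<in> tuples 3 V"
  obtains a b c where "xs = [a, b, c]" "a \<in> V" "b \<in> V" "c \<in> V"
  using assms by (auto simp: tuples_def numeral_3_eq_3 length_Suc_conv)

lemma all_less_3: "(\<forall>i<3. P i) \<longleftrightarrow> P 0 \<and> P (Suc 0) \<and> P (2::nat)"
  by (auto simp: numeral_3_eq_3 numeral_2_eq_2 less_Suc_eq)

lemma majority_not_asteroidal:
  assumes "is_graph G" and pol: "polymorphism 3 G \<phi>" and cons: "conservative 3 (verts G) \<phi>"
    and nu: "nu3 (verts G) \<phi>" and V: "a \<in> verts G" "b \<in> verts G" "c \<in> verts G"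
  shows "\<not> asteroidal (edges G) a b c"
proof
  assume "asteroidal (edges G) a b c"
  then have s: "separated (edges G) a b c" "separated (edges G) b a c" "separated (edges G) c a b"
    by (auto simp: asteroidal_def)
  have sub: "edges G \<subseteq> verts G \<times> verts G" using assms(1) by (simp add: is_graph_def)
  have c3: "\<phi> [x, y, z] \<in> {x, y, z}" if "x \<in> verts G" "y \<in> verts G" "z \<in> verts G" for x y z
    using cons that tuples_3[of x y z] unfolding conservative_def by fastforce
  have p3: "(\<phi> [x, y, z], \<phi> [x', y', z']) \<in> edges G"
    if "(x, x') \<in> edges G" "(y, y') \<in> edges G" "(z, z') \<in> edges G" for x y z x' y' z'
  proof -
    have "[x, y, z] \<in> tuples 3 (verts G)" "[x', y', z'] \<in> tuples 3 (verts G)"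
      using that sub by (auto simp: tuples_3)
    then show ?thesis using pol that unfolding polymorphism_def all_less_3 by fastforce
  qed
  have "\<phi> [a, b, c] \<noteq> a"
    by (rule separated_not_selected[where m = "\<lambda>x y z. \<phi> [x, y, z]", OF s(1) sub])
      (use V c3 p3 nu in \<open>auto simp: nu3_def\<close>)
  moreover have "\<phi> [a, b, c] \<noteq> b"
    by (rule separated_not_selected[where m = "\<lambda>x y z. \<phi> [y, x, z]", OF s(2) sub])
      (use V c3 p3 nu in \<open>fastforce simp: nu3_def\<close>)+
  moreover have "\<phi> [a, b, c] \<noteq> c"
    by (rule separated_not_selected[where m = "\<lambda>x y z. \<phi> [y, z, x]", OF s(3) sub])
      (use V c3 p3 nu in \<open>fastforce simp: nu3_def\<close>)+
  ultimately show False using c3[OF V] by auto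
qed

section \<open>Weak near unanimity excludes asteroidal triples\<close>

text \<open>
  A \<open>k\<close>-ary operation acts here on functions \<open>nat \<Rightarrow> 'v\<close>, of which it sees the arguments below \<open>k\<close>.
  Sets of positions may contain numbers above \<open>k\<close>, so that complements can be taken in \<open>nat\<close>.
\<close>

locale conservative_wnu_graph =
  fixes V :: "'v set" and E :: "('v \<times> 'v) set" and k :: nat and w :: "(nat \<Rightarrow> 'v) \<Rightarrow> 'v"
  assumes sub: "E \<subseteq> V \<times> V" and symE: "sym E" and k2: "k \<ge> 2"
    and cong: "\<And>f g. (\<And>i. i < k \<Longrightarrow> f i = g i) \<Longrightarrow> w f = w g"
    and cons: "\<And>f. (\<And>i. i < k \<Longrightarrow> f i \<in> V) \<Longrightarrow> w f \<in> f ` {..<k}"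
    and pol: "\<And>f g. (\<And>i. i < k \<Longrightarrow> (f i, g i) \<in> E) \<Longrightarrow> (w f, w g) \<in> E"
    and wnu: "\<And>x y i j. x \<in> V \<Longrightarrow> y \<in> V \<Longrightarrow> i < k \<Longrightarrow> j < k
      \<Longrightarrow> w ((\<lambda>_. x)(i := y)) = w ((\<lambda>_. x)(j := y))"
begin

section \<open>Restrictions of the operation to pairs and triples of vertices\<close>

abbreviation adj (infix "\<sim>" 50) where "x \<sim> y \<equiv> (x, y) \<in> E"
abbreviation nadj (infix "\<nsim>" 50) where "x \<nsim> y \<equiv> (x, y) \<notin> E"

definition duo :: "nat set \<Rightarrow> 'v \<Rightarrow> 'v \<Rightarrow> 'v" where
  "duo A x y = w (\<lambda>i. if i \<in> A then x else y)"

definition trio :: "nat set \<Rightarrow> nat set \<Rightarrow> 'v \<Rightarrow> 'v \<Rightarrow> 'v \<Rightarrow> 'v" where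
  "trio A B x y z = w (\<lambda>i. if i \<in> A then x else if i \<in> B then y else z)"

definition wins :: "'v \<Rightarrow> 'v \<Rightarrow> nat set \<Rightarrow> bool" where
  "wins x y A \<longleftrightarrow> duo A x y = x"

lemma commute: "x \<sim> y \<longleftrightarrow> y \<sim> x"
  using symE by (auto dest: symD)

lemma in_V: "x \<sim> y \<Longrightarrow> x \<in> V" "x \<sim> y \<Longrightarrow> y \<in> V"
  using sub by auto

lemma duo_cases: "x \<in> V \<Longrightarrow> y \<in> V \<Longrightarrow> duo A x y = x \<or> duo A x y = y"
  using cons[of "\<lambda>i. if i \<in> A then x else y"] unfolding duo_def by force

lemma trio_cases:
  "x \<in> V \<Longrightarrow> y \<in> V \<Longrightarrow> z \<in> V \<Longrightarrow> trio A B x y z = x \<or> trio A B x y z = y \<or> trio A B x y z = z"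
  using cons[of "\<lambda>i. if i \<in> A then x else if i \<in> B then y else z"] unfolding trio_def by force

lemma trio_adj: "x \<sim> x' \<Longrightarrow> y \<sim> y' \<Longrightarrow> z \<sim> z' \<Longrightarrow> trio A B x y z \<sim> trio A B x' y' z'"
  unfolding trio_def by (rule pol) auto

lemma duo_adj: "x \<sim> x' \<Longrightarrow> y \<sim> y' \<Longrightarrow> duo A x y \<sim> duo A x' y'"
  unfolding duo_def by (rule pol) auto

lemma duo_compl: "duo (- A) x y = duo A y x"
  unfolding duo_def by (rule arg_cong[where f = w]) auto

lemma trio_12: "trio A B x x y = duo (A \<union> B) x y"
  and trio_23: "trio A B x y y = duo A x y"
  and trio_13: "trio A B x y x = duo (- (B - A)) x y"
  unfolding duo_def trio_def by (rule arg_cong[where f = w]; auto)+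

lemma trio_swap: "A \<inter> B = {} \<Longrightarrow> trio A B x y z = trio B A y x z"
  and trio_rotate: "A \<inter> B = {} \<Longrightarrow> trio A B x y z = trio (- (A \<union> B)) A z x y"
  unfolding trio_def by (rule arg_cong[where f = w]; force)+

lemma wins_compl: "x \<in> V \<Longrightarrow> y \<in> V \<Longrightarrow> x \<noteq> y \<Longrightarrow> wins y x A \<longleftrightarrow> \<not> wins x y (- A)"
  using duo_cases[of x y "- A"] by (auto simp: wins_def duo_compl)

text \<open>The value on \<open>p\<close> and \<open>q\<close> is adjacent to \<open>x\<close>,
  which rules out \<open>q\<close>.\<close>

lemma wins_mono:
  assumes "x \<sim> p" "y \<sim> q" "x \<nsim> q" "wins x y A"
  shows "wins p q A"
  using duo_adj[OF assms(1,2), of A] assms duo_cases[of p q A] in_V by (auto simp: wins_def)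

lemma wins_eq:
  assumes "x \<sim> p" "y \<sim> q" "x \<nsim> q" "y \<nsim> p"
  shows "wins x y = wins p q"
  using wins_mono[of x p y q] wins_mono[of p x q y] assms commute by blast

lemma wins_all: "x \<in> V \<Longrightarrow> y \<in> V \<Longrightarrow> wins x y {..<k}"
  using cons[of "\<lambda>i. if i < k then x else y"] by (auto simp: wins_def duo_def)

lemma wins_singleton: "x \<in> V \<Longrightarrow> y \<in> V \<Longrightarrow> i < k \<Longrightarrow> j < k \<Longrightarrow> wins x y {i} \<longleftrightarrow> wins x y {j}"
  using wnu[of y x i j] by (simp add: wins_def duo_def fun_upd_def)

section \<open>Triples whose pairs carry one self-dual Boolean function\<close>

definition balanced :: "'v \<Rightarrow> 'v \<Rightarrow> 'v \<Rightarrow> bool" where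
  "balanced a b c \<longleftrightarrow> a \<in> V \<and> b \<in> V \<and> c \<in> V \<and> a \<noteq> b \<and> a \<noteq> c \<and> b \<noteq> c \<and>
    wins a b = wins a c \<and> wins b a = wins b c \<and> wins c a = wins c b"

text \<open>Each pair makes the functions of its two members dual to each other. Going around the
  triangle dualises three times, so each function is self-dual and all three coincide.\<close>

lemma balanced_wins:
  assumes "balanced a b c"
  shows "wins a c = wins a b" "wins b a = wins a b" "wins b c = wins a b" "wins c a = wins a b"
    "wins c b = wins a b" "wins a b (- A) \<longleftrightarrow> \<not> wins a b A"
proof -
  have V: "a \<in> V" "b \<in> V" "c \<in> V" and ne: "a \<noteq> b" "a \<noteq> c" "b \<noteq> c"
    and eq: "wins a c = wins a b" "wins b c = wins b a" "wins c b = wins c a"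
    using assms by (auto simp: balanced_def)
  have ab: "wins b a A \<longleftrightarrow> \<not> wins a b (- A)" for A using wins_compl[of a b] V ne by simp
  have ac: "wins c a A \<longleftrightarrow> \<not> wins a b (- A)" for A using wins_compl[of a c] V ne eq by simp
  have bc: "wins c a A \<longleftrightarrow> \<not> wins b a (- A)" for A using wins_compl[of b c] V ne eq by simp
  have sd: "wins a b (- A) \<longleftrightarrow> \<not> wins a b A" for A using ab[of "- A"] ac[of A] bc[of A] by simp
  then show "wins a b (- A) \<longleftrightarrow> \<not> wins a b A" .
  show "wins a c = wins a b" by fact
  show "wins b a = wins a b" using ab sd by auto
  then show "wins b c = wins a b" using eq by simp
  show "wins c a = wins a b" using ac sd by auto
  then show "wins c b = wins a b" using eq by simp
qed

text \<open>The blocks are an initial segment, the next position \<open>j\<close>, and the rest. All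
  singletons have the same value; where adding \<open>j\<close> changes the value of the segment,
  self-duality gives the rest the value of a singleton.\<close>

lemma balanced_partition:
  assumes "balanced a b c"
  obtains A B where "A \<inter> B = {}" "wins a b B = wins a b A" "wins a b (- (A \<union> B)) = wins a b A"
proof -
  let ?g = "wins a b"
  have V: "a \<in> V" "b \<in> V" using assms by (auto simp: balanced_def)
  note sd = balanced_wins(6)[OF assms]
  have single: "?g {i} = ?g {0}" if "i < k" for i using wins_singleton[of a b i 0] V that k2 by simp
  have "\<exists>j<k. ?g {..<j} = ?g {0} \<and> ?g {..<Suc j} \<noteq> ?g {0}"
  proof -
    have "\<exists>n\<in>{1..k}. ?g {..<n} \<noteq> ?g {0}"
    \<comment> \<open>If singletons lose, the full set of positions is the witness; if they win, all
      positions but the last, which lose by self-duality.\<close>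
    proof (cases "?g {0}")
      case False
      then show ?thesis using wins_all[OF V] k2 by (intro bexI[of _ k]) auto
    next
      case True
      have "?g (- {..<k - 1}) = ?g {k - 1}"
        unfolding wins_def duo_def by (subst cong[of _ "\<lambda>i. if i \<in> {k - 1} then a else b"]) auto
      then have "\<not> ?g {..<k - 1}" using single[of "k - 1"] True sd[of "{..<k - 1}"] k2 by simp
      then show ?thesis using k2 True by (intro bexI[of _ "k - 1"]) auto
    qed
    then obtain n where n: "1 \<le> n" "n \<le> k" "?g {..<n} \<noteq> ?g {0}" by auto
    have "?g {..<1} = ?g {0}" by (simp add: lessThan_Suc)
    with n(1,3) have "\<exists>j\<ge>1. j < n \<and> ?g {..<j} = ?g {0} \<and> ?g {..<Suc j} \<noteq> ?g {0}"
    proof (induction n rule: dec_induct)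
      case base then show ?case by simp
    next
      case (step n)
      then show ?case by (cases "?g {..<n} = ?g {0}") (auto intro: less_SucI)
    qed
    then show ?thesis using n(2) less_le_trans by blast
  qed
  then obtain j where j: "j < k" "?g {..<j} = ?g {0}" "?g {..<Suc j} \<noteq> ?g {0}" by auto
  have "{..<j} \<union> {j} = {..<Suc j}" by auto
  then show ?thesis using that[of "{..<j}" "{j}"] j single[of j] sd[of "{..<Suc j}"] by auto
qed

text \<open>As \<open>z\<close> is adjacent to both \<open>p\<close> and \<open>q\<close>, its
  positions may be paired with either; the value \<open>x\<close>, not adjacent to \<open>q\<close>,
  forces \<open>p\<close> both times. For blocks of equal value under a self-dual function the two
  conclusions clash.\<close>

lemma trio_first:
  assumes "x \<sim> p" "y \<sim> q" "z \<sim> p" "z \<sim> q" "x \<nsim> q" "y \<nsim> p" "A \<inter> B = {}"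
    and val: "trio A B x y z = x"
  shows "wins x y A" "wins x y (- B)"
proof -
  have V: "p \<in> V" "q \<in> V" using assms in_V by blast+
  have eq: "wins x y = wins p q" using assms wins_eq by blast
  have "x \<sim> duo A p q" using trio_adj[of x p y q z q A B] assms by (simp add: trio_23)
  then show "wins x y A" using duo_cases[OF V, of A] assms(5) eq by (auto simp: wins_def)
  have "- (B - A) = - B" using assms(7) by auto
  then have "x \<sim> duo (- B) p q" using trio_adj[of x p y q z p A B] assms by (simp add: trio_13)
  then show "wins x y (- B)" using duo_cases[OF V, of "- B"] assms(5) eq by (auto simp: wins_def)
qed

text \<open>
  The six vertices need not be distinct: they form an induced hexagon in the bipartite double cover
  of the graph.
\<close>

lemma no_hexagon:
  assumes "a \<sim> u" "u \<sim> v" "v \<sim> d" "d \<sim> b" "b \<sim> c" "c \<sim> a" "a \<nsim> d" "u \<nsim> b" "v \<nsim> c"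
  shows False
proof -
  have V: "a \<in> V" "b \<in> V" "v \<in> V" "u \<in> V" "c \<in> V" "d \<in> V" using assms in_V by blast+
  \<comment> \<open>In the hexagon \<open>x p y q z r\<close>, opposite edges identify the functions
    of \<open>(x, y)\<close> and \<open>(r, q)\<close>, and of \<open>(x, z)\<close> and
    \<open>(p, q)\<close>. The one-sided transfers from \<open>(x, y)\<close> to
    \<open>(p, q)\<close> and from \<open>(x, z)\<close> to \<open>(r, q)\<close> close the circle
    of implications.\<close>
  have rot: "wins x y = wins x z"
    if "x \<sim> p" "p \<sim> y" "y \<sim> q" "q \<sim> z" "z \<sim> r" "r \<sim> x" "x \<nsim> q" "p \<nsim> z" "y \<nsim> r" for x y z p q r
  proof -
    have "wins x y = wins r q" "wins x z = wins p q"
      using that commute by (auto intro!: wins_eq)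
    moreover have "wins x y A \<Longrightarrow> wins p q A" "wins x z A \<Longrightarrow> wins r q A" for A
      using that commute wins_mono[of x p y q A] wins_mono[of x r z q A] by blast+
    ultimately show ?thesis by auto
  qed
  have bal: "balanced a b v"
    unfolding balanced_def
  proof (intro conjI)
    show "wins a b = wins a v" using rot[of a u v d b c] assms commute by metis
    show "wins b a = wins b v" using rot[of b c a u v d] assms commute by metis
    show "wins v a = wins v b" using rot[of v d b c a u] assms commute by metis
  qed (use V assms commute in metis)+
  obtain A B where AB: "A \<inter> B = {}" "wins a b B = wins a b A" "wins a b (- (A \<union> B)) = wins a b A"
    using balanced_partition[OF bal] .
  note g = balanced_wins[OF bal]
  have "trio A B a b v \<noteq> a"
    using trio_first[of a u b d v A B] assms commute AB g(6)[of B] by metis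
  moreover have "trio A B a b v \<noteq> b"
    using trio_first[of b d a u v B A] trio_swap[of A B a b v] assms commute AB g(2) g(6)[of A]
    by (metis Int_commute)
  moreover have "trio A B a b v \<noteq> v"
  proof
    assume "trio A B a b v = v"
    then have "trio (- (A \<union> B)) A v a b = v" using trio_rotate AB(1) by metis
    then have "wins v a (- (A \<union> B))" "wins v a (- A)"
      using trio_first[of v d a c b "- (A \<union> B)" A] assms commute by blast+
    then show False using g AB by simp
  qed
  ultimately show False using trio_cases V by blast
qed

text \<open>In the bipartite double cover \<open>p b u' a u c q\<close> is an induced path: by
  \<open>no_hexagon\<close> the chords \<open>c p\<close> and \<open>b q\<close> are absent. Pairing
  the triple with \<open>u, p, u\<close> leaves only the value \<open>b\<close>, pairing it with
  \<open>u', u', q\<close> only \<open>c\<close>.\<close>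

lemma no_bent_path:
  assumes "a \<sim> u" "c \<sim> u" "b \<nsim> u" "a \<sim> u'" "b \<sim> u'" "c \<nsim> u'"
    and "b \<sim> p" "a \<nsim> p" "c \<sim> q" "a \<nsim> q"
    and eq: "wins a b = wins a c" and AB: "A \<inter> B = {}"
    and lose: "\<not> wins a b (- B)" "\<not> wins a b (A \<union> B)"
  shows False
proof -
  have V: "a \<in> V" "b \<in> V" "c \<in> V" "u \<in> V" "p \<in> V" "u' \<in> V" "q \<in> V"
    using assms in_V by blast+
  have n: "c \<nsim> p" "b \<nsim> q"
    using no_hexagon[of a u' b p c u] no_hexagon[of a u' b q c u] assms commute by blast+
  have "duo (- B) u p \<noteq> u"
    using wins_eq[of a u b p] assms lose by (auto simp: wins_def)
  moreover have "- (B - A) = - B" using AB by auto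
  then have "trio A B a b c \<sim> duo (- B) u p"
    using trio_adj[of a u b p c u A B] assms by (simp add: trio_13)
  ultimately have b: "trio A B a b c = b"
    using duo_cases[OF V(4,5), of "- B"] trio_cases[OF V(1-3), of A B] assms n by metis
  have "duo (A \<union> B) u' q \<noteq> u'"
    using wins_eq[of a u' c q] assms lose by (auto simp: wins_def)
  moreover have "trio A B a b c \<sim> duo (A \<union> B) u' q"
    using trio_adj[of a u' b u' c q A B] assms by (simp add: trio_12)
  ultimately show False
    using duo_cases[OF V(6,7), of "A \<union> B"] b n by metis
qed

section \<open>Transfer of Boolean functions along separating walks\<close>

definition escapes :: "'v \<Rightarrow> 'v \<Rightarrow> bool" where
  "escapes x y \<longleftrightarrow> (\<exists>u. x \<sim> u \<and> y \<nsim> u)"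

text \<open>A separating walk gives nonadjacency in one direction, whereas \<open>wins_eq\<close>
  asks for both. The two failures of neighbourhood inclusion supply a detour when \<open>b\<close>
  and \<open>c\<close> are adjacent.\<close>

lemma wins_step:
  assumes "a \<sim> c" "b \<sim> d" "a \<nsim> d" "escapes a b" "escapes d c"
  shows "wins a b = wins c d"
proof -
  obtain u v where uv: "a \<sim> u" "b \<nsim> u" "d \<sim> v" "c \<nsim> v"
    using assms(4,5) by (auto simp: escapes_def)
  show ?thesis
  proof (cases "b \<sim> c")
    case False
    then show ?thesis using wins_eq assms by blast
  next
    case True
    text \<open>The pair \<open>(a, b)\<close> reaches \<open>(c, d)\<close> by reversible steps through \<open>(u, d)\<close> and \<open>(a, v)\<close>.\<close>
    then have "u \<nsim> v" using no_hexagon[of a u v d b c] assms uv commute by blast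
    then have "wins a b = wins u d" "wins u d = wins a v" "wins a v = wins c d"
      using assms uv commute by (auto intro!: wins_eq)
    then show ?thesis by simp
  qed
qed

text \<open>\<open>wins_step\<close> carries both pairs along the walks; its second
  \<open>escapes\<close> hypothesis comes from the following step. Where the other two walks meet,
  \<open>no_hexagon\<close> takes over.\<close>

lemma wins_separated:
  assumes "separated E a b c" "escapes a b" "escapes a c"
  shows "wins a b = wins a c"
  using assms
proof (induction rule: separated.induct)
  case base
  show ?case ..
next
  case (step a a' b b' c c')
  show ?case
  proof (cases "b' = c'")
    case True
    obtain u u' where u: "a \<sim> u" "b \<nsim> u" "a \<sim> u'" "c \<nsim> u'"
      using step.prems by (auto simp: escapes_def)
    have "wins a b = wins u b'" "wins a c = wins u' b'"
      using step u True by (auto intro!: wins_eq)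
    moreover have "c \<nsim> u \<or> b \<nsim> u'"
      using no_hexagon[of a u' b b' c u] step u True commute by blast
    then have "wins a c = wins u b' \<or> wins a b = wins u' b'"
      using step u True wins_eq by metis
    ultimately show ?thesis by auto
  next
    case False
    then obtain x y where "b' \<sim> x" "a' \<nsim> x" "c' \<sim> y" "a' \<nsim> y"
      using separated_stepE[OF step.hyps(6)] by metis
    then have "escapes b' a'" "escapes c' a'" by (auto simp: escapes_def)
    moreover have "escapes a' b'" "escapes a' c'"
      using step.hyps commute unfolding escapes_def by blast+
    ultimately show ?thesis
      using step wins_step[of a a' b b'] wins_step[of a a' c c'] by metis
  qed
qed

text \<open>The value \<open>a\<close> is pushed forward: the value at the next triple is adjacent
  to \<open>a\<close>, so it can only be \<open>a'\<close>. Where the other walks meet, the triple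
  becomes a pair.\<close>

lemma separated_value_wins:
  assumes "separated E a b c" "escapes a b" "escapes a c" "trio A B a b c = a"
  shows "wins a b A"
  using assms
proof (induction rule: separated.induct)
  case (base a b)
  then show ?case by (simp add: trio_23 wins_def)
next
  case (step a a' b b' c c')
  have V: "a' \<in> V" "b' \<in> V" "c' \<in> V" using step in_V by blast+
  show ?case
  proof (cases "b' = c'")
    case True
    obtain u where u: "a \<sim> u" "b \<nsim> u" using step.prems by (auto simp: escapes_def)
    have "a \<sim> duo A u b'"
      using trio_adj[of a u b b' c c' A B] step u True by (simp add: trio_23)
    then have "wins u b' A"
      using duo_cases[of u b' A] V u in_V step by (metis wins_def)
    then show ?thesis using wins_eq[of a u b b'] step u by simp
  next
    case False
    then obtain x where "b' \<sim> x" "a' \<nsim> x"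
      using separated_stepE[OF step.hyps(6)] by metis
    then have "escapes b' a'" by (auto simp: escapes_def)
    then have "wins a b = wins a' b'" using wins_step step by blast
    moreover have "escapes a' b'" "escapes a' c'"
      using step.hyps commute unfolding escapes_def by blast+
    moreover have "trio A B a' b' c' = a'"
      using trio_adj[of a a' b b' c c' A B] step trio_cases[OF V, of A B] by metis
    ultimately show ?thesis using step by simp
  qed
qed

text \<open>Partial converse of \<open>separated_value_wins\<close>, by backward induction. The
  losing hypotheses yield, through \<open>no_bent_path\<close>, a neighbour \<open>u\<close> of
  \<open>a\<close> adjacent to neither \<open>b\<close> nor \<open>c\<close>, so a value
  \<open>u\<close> one step ahead forces \<open>a\<close>.\<close>

lemma separated_wins_value:
  assumes "separated E a b c" "escapes a b" "escapes a c" "wins a b = wins a c" "A \<inter> B = {}"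
    and "wins a b A" "\<not> wins a b (- B)" "\<not> wins a b (A \<union> B)"
  shows "trio A B a b c = a"
  using assms
proof (induction rule: separated.induct)
  case (base a b)
  then show ?case by (simp add: trio_23 wins_def)
next
  case (step a a' b b' c c')
  have V: "a \<in> V" "b \<in> V" "c \<in> V" "a' \<in> V" "b' \<in> V" "c' \<in> V" using step in_V by blast+
  obtain u where u: "a \<sim> u" "b \<nsim> u" "c \<nsim> u"
  proof -
    obtain u u' where "a \<sim> u" "b \<nsim> u" "a \<sim> u'" "c \<nsim> u'"
      using step.prems by (auto simp: escapes_def)
    then show ?thesis
      using that no_bent_path[of a u c b u' b' c' A B] step by blast
  qed
  have "trio A B u b' c' = u"
  proof (cases "b' = c'")
    case True
    have "wins u b' A" using wins_eq[of a u b b'] step u by simp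
    then show ?thesis using True by (simp add: trio_23 wins_def)
  next
    case False
    \<comment> \<open>The induction hypothesis concerns \<open>a'\<close>, not \<open>u\<close>. The
      triple \<open>a, x, y\<close> links the two, since \<open>a'\<close> is adjacent to neither
      \<open>x\<close> nor \<open>y\<close>, and \<open>a\<close> to neither \<open>b'\<close> nor
      \<open>c'\<close>.\<close>
    then obtain x y where x: "b' \<sim> x" "a' \<nsim> x" "c' \<sim> y" "a' \<nsim> y"
      using separated_stepE[OF step.hyps(6)] by metis
    then have "escapes b' a'" "escapes c' a'" by (auto simp: escapes_def)
    then have "wins a b = wins a' b'" "wins a c = wins a' c'"
      using wins_step step by blast+
    moreover have "escapes a' b'" "escapes a' c'"
      using step.hyps commute unfolding escapes_def by blast+
    ultimately have "trio A B a' b' c' = a'" using step by simp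
    moreover have "trio A B a' b' c' \<sim> trio A B a x y"
      using x step commute by (intro trio_adj) auto
    ultimately have "trio A B a x y = a"
      using trio_cases[of a x y A B] x V in_V by metis
    moreover have "trio A B a x y \<sim> trio A B u b' c'"
      using x u commute by (intro trio_adj) auto
    ultimately show ?thesis
      using trio_cases[of u b' c' A B] step u V in_V by metis
  qed
  moreover have "trio A B a b c \<sim> trio A B u b' c'"
    using step u by (intro trio_adj) auto
  ultimately show ?case using trio_cases[OF V(1-3), of A B] u by metis
qed

lemma not_asteroidal: "\<not> asteroidal E a b c"
proof
  assume "asteroidal E a b c"
  then have s: "separated E a b c" "separated E b a c" "separated E c a b"
    by (auto simp: asteroidal_def)
  have ne: "a \<noteq> b" "a \<noteq> c" "b \<noteq> c" using s not_separated_self by metis+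
  \<comment> \<open>The vertices are distinct, so each separation begins with a step, whose
    nonadjacencies are the required escapes.\<close>
  have esc: "escapes b a" "escapes c a" "escapes a b" "escapes c b" "escapes a c" "escapes b c"
    using ne by (auto simp: escapes_def intro: separated_stepE[OF s(1)]
      separated_stepE[OF s(2)] separated_stepE[OF s(3)])
  have bal: "balanced a b c"
    unfolding balanced_def using ne wins_separated[OF s(1)] wins_separated[OF s(2)]
      wins_separated[OF s(3)] esc in_V by (auto simp: escapes_def)
  note g = balanced_wins[OF bal]
  have V: "a \<in> V" "b \<in> V" "c \<in> V" using bal by (auto simp: balanced_def)
  obtain A B where AB: "A \<inter> B = {}" "wins a b B = wins a b A" "wins a b (- (A \<union> B)) = wins a b A"
    using balanced_partition[OF bal] .
  then have BA: "B \<inter> A = {}" by auto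
  have swap: "trio B A b a c = trio A B a b c" using trio_swap BA by metis
  have rot: "trio (- (A \<union> B)) A c a b = trio A B a b c" using trio_rotate AB(1) by metis
  show False
  \<comment> \<open>Winning blocks force two different values; losing blocks exclude all
    three.\<close>
  proof (cases "wins a b A")
    case True
    then have "\<not> wins a b (- B)" "\<not> wins a b (- A)" "\<not> wins a b (A \<union> B)"
      using AB g(6)[of A] g(6)[of B] g(6)[of "A \<union> B"] by auto
    then have "trio A B a b c = a" "trio B A b a c = b"
      using separated_wins_value[OF s(1) esc(3,5) _ AB(1)] separated_wins_value[OF s(2) esc(1,6) _ BA]
        True AB g(1-5) by (auto simp: Un_commute)
    then show False using swap ne by simp
  next
    case False
    then have "trio A B a b c \<noteq> a" "trio A B a b c \<noteq> b" "trio A B a b c \<noteq> c"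
      using separated_value_wins[OF s(1) esc(3,5), of A B]
        separated_value_wins[OF s(2) esc(1,6), of B A]
        separated_value_wins[OF s(3) esc(2,4), of "- (A \<union> B)" A] AB g swap rot by auto
    then show False using trio_cases[OF V] by blast
  qed
qed

end

lemma wnu_not_asteroidal:
  assumes "is_graph G" "polymorphism k G \<phi>" "conservative k (verts G) \<phi>" "wnu k (verts G) \<phi>"
  shows "\<not> asteroidal (edges G) a b c"
proof -
  have sub: "edges G \<subseteq> verts G \<times> verts G" "sym (edges G)" using assms(1) by (auto simp: is_graph_def)
  have upd: "map ((\<lambda>_. x)(i := y)) [0..<k] = (replicate k x)[i := y]" for x y :: 'a and i
    by (rule nth_equalityI) (auto simp: nth_list_update)
  interpret conservative_wnu_graph "verts G" "edges G" k "\<lambda>f. \<phi> (map f [0..<k])"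
  proof
    show "edges G \<subseteq> verts G \<times> verts G" "sym (edges G)" using sub .
    show "2 \<le> k" using assms(4) by (simp add: wnu_def)
  next
    fix f g :: "nat \<Rightarrow> 'a"
    assume "\<And>i. i < k \<Longrightarrow> f i = g i"
    then show "\<phi> (map f [0..<k]) = \<phi> (map g [0..<k])" by (intro arg_cong[where f = \<phi>]) auto
  next
    fix f assume "\<And>i. i < k \<Longrightarrow> f i \<in> verts G"
    then have "map f [0..<k] \<in> tuples k (verts G)" by (auto simp: tuples_def)
    then have "\<phi> (map f [0..<k]) \<in> set (map f [0..<k])"
      using assms(3) unfolding conservative_def by blast
    then show "\<phi> (map f [0..<k]) \<in> f ` {..<k}" by (simp add: atLeast0LessThan)
  next
    fix f g assume fg: "\<And>i. i < k \<Longrightarrow> (f i, g i) \<in> edges G"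
    then have "f i \<in> verts G \<and> g i \<in> verts G" if "i < k" for i
      using sub(1) that by blast
    then have "map f [0..<k] \<in> tuples k (verts G)" "map g [0..<k] \<in> tuples k (verts G)"
      by (auto simp: tuples_def)
    moreover have "\<forall>i<k. (map f [0..<k] ! i, map g [0..<k] ! i) \<in> edges G"
      using fg by simp
    ultimately show "(\<phi> (map f [0..<k]), \<phi> (map g [0..<k])) \<in> edges G"
      using assms(2) unfolding polymorphism_def by blast
  next
    fix x y i j assume "x \<in> verts G" "y \<in> verts G" "i < k" "j < k"
    then show "\<phi> (map ((\<lambda>_. x)(i := y)) [0..<k]) = \<phi> (map ((\<lambda>_. x)(j := y)) [0..<k])"
      unfolding upd using assms(4) unfolding wnu_def by blast
  qed
  show ?thesis by (rule not_asteroidal)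
qed

section \<open>The switching graph\<close>

definition majority :: "('v \<times> 'v) set \<Rightarrow> 'v list \<Rightarrow> 'v" where
  "majority E xs = first_unseparated E (xs ! 0) (xs ! 1) (xs ! 2)"

lemma majority_conservative: "conservative 3 V (majority E)"
  unfolding conservative_def by (auto elim!: tuples_3E simp: majority_def first_unseparated_def)

lemma majority_nu3: "nu3 V (majority E)"
  by (simp add: nu3_def majority_def first_unseparated_nu)

lemma nu3_wnu: "nu3 V \<phi> \<Longrightarrow> wnu 3 V \<phi>"
  by (auto simp: nu3_def wnu_def idempotent_def numeral_3_eq_3 less_Suc_eq)

lemma majority_polymorphism:
  assumes "is_graph G"
    and "\<And>a b c. a \<in> verts G \<Longrightarrow> b \<in> verts G \<Longrightarrow> c \<in> verts G \<Longrightarrow> \<not> asteroidal (edges G) a b c"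
  shows "polymorphism 3 G (majority (edges G))"
  unfolding polymorphism_def
proof (intro conjI ballI impI)
  fix xs assume "xs \<in> tuples 3 (verts G)"
  then show "majority (edges G) xs \<in> verts G"
    by (auto elim!: tuples_3E simp: majority_def first_unseparated_def)
next
  fix xs ys assume xs: "xs \<in> tuples 3 (verts G)" "ys \<in> tuples 3 (verts G)"
    and e: "\<forall>i<3. (xs ! i, ys ! i) \<in> edges G"
  show "(majority (edges G) xs, majority (edges G) ys) \<in> edges G"
    unfolding majority_def
    using xs e assms by (intro first_unseparated_polymorphism) (auto elim!: tuples_3E simp: is_graph_def)
qed

section \<open>The twin automorphism and the blue edges\<close>

definition twin :: "'v \<times> nat \<Rightarrow> 'v \<times> nat" where
  "twin = (\<lambda>(v, i). (v, if i = 1 then 2 else if i = 2 then 1 else i))"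

lemma twin_twin [simp]: "twin (twin x) = x"
  by (cases x) (simp add: twin_def)

lemma inj_twin: "inj twin"
  by (metis injI twin_twin)

lemma twin_red: "(twin x, twin y) \<in> red (switching_graph H) \<longleftrightarrow> (x, y) \<in> red (switching_graph H)"
  by (cases x; cases y) (auto simp: twin_def switching_graph_def)

lemma blue_iff_twin_red: "(x, y) \<in> blue (switching_graph H) \<longleftrightarrow> (x, twin y) \<in> red (switching_graph H)"
  by (cases x; cases y) (auto simp: twin_def switching_graph_def)

lemma twin_verts: "x \<in> br_verts (switching_graph H) \<Longrightarrow> twin x \<in> br_verts (switching_graph H)"
  by (cases x) (auto simp: twin_def switching_graph_def)

lemma first_unseparated_twin:
  fixes H :: "'v brgraph"
  defines "E \<equiv> red (switching_graph H)"
  shows "first_unseparated E (twin x) (twin y) (twin z) = twin (first_unseparated E x y z)"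
proof -
  have "separated E (twin a) (twin b) (twin c) \<longleftrightarrow> separated E a b c" for a b c
    using separated_automorphism[OF _ inj_twin, of E] twin_red twin_twin unfolding E_def by metis
  then show ?thesis by (simp add: first_unseparated_def)
qed

lemma switching_graph_red_graph:
  assumes "is_brgraph H"
  shows "is_graph (red_graph (switching_graph H))"
  using assms unfolding is_brgraph_def is_graph_def red_graph_def blue_graph_def switching_graph_def
  by (auto intro!: symI dest: symD)

lemma majority_br_polymorphism:
  assumes "polymorphism 3 (red_graph (switching_graph H)) (majority (red (switching_graph H)))"
  shows "br_polymorphism 3 (switching_graph H) (majority (red (switching_graph H)))"
proof -
  let ?V = "br_verts (switching_graph H)"
  let ?m = "majority (red (switching_graph H))"
  have "(?m xs, ?m ys) \<in> blue (switching_graph H)"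
    if xs: "xs \<in> tuples 3 ?V" "ys \<in> tuples 3 ?V" and e: "\<forall>i<3. (xs ! i, ys ! i) \<in> blue (switching_graph H)"
    for xs ys
  proof -
    have ys': "map twin ys \<in> tuples 3 ?V" using xs twin_verts by (fastforce simp: tuples_def)
    have len: "length ys = 3" using xs by (simp add: tuples_def)
    then have "\<forall>i<3. (xs ! i, map twin ys ! i) \<in> red (switching_graph H)"
      using e by (simp add: blue_iff_twin_red)
    then have "(?m xs, ?m (map twin ys)) \<in> red (switching_graph H)"
      using assms xs ys' by (simp add: polymorphism_def red_graph_def)
    moreover have "?m (map twin ys) = twin (?m ys)"
      using len by (simp add: majority_def first_unseparated_twin)
    ultimately show ?thesis by (simp add: blue_iff_twin_red)
  qed
  then show ?thesis
    using assms by (auto simp: br_polymorphism_def polymorphism_def red_graph_def blue_graph_def)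
qed

theorem theorem3p4:
  fixes H :: "'v brgraph"
  assumes "is_brgraph H"
  shows "(\<exists>\<phi>. polymorphism 3 (red_graph (switching_graph H)) \<phi>
             \<and> conservative 3 (verts (red_graph (switching_graph H))) \<phi>
             \<and> nu3 (verts (red_graph (switching_graph H))) \<phi>)
    \<longleftrightarrow> (\<exists>k \<phi>. br_polymorphism k (switching_graph H) \<phi>
             \<and> conservative k (br_verts (switching_graph H)) \<phi>
             \<and> wnu k (br_verts (switching_graph H)) \<phi>)"
    (is "?maj \<longleftrightarrow> ?wnu")
proof
  let ?G = "red_graph (switching_graph H)"
  have V: "verts ?G = br_verts (switching_graph H)" and E: "edges ?G = red (switching_graph H)"
    by (simp_all add: red_graph_def)
  note G = switching_graph_red_graph[OF assms]
  show ?wnu if ?maj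
  proof -
    have "\<not> asteroidal (edges ?G) a b c" if "a \<in> verts ?G" "b \<in> verts ?G" "c \<in> verts ?G" for a b c
      using \<open>?maj\<close> majority_not_asteroidal[OF G] that by blast
    then have "polymorphism 3 ?G (majority (edges ?G))" using majority_polymorphism[OF G] by blast
    then have "br_polymorphism 3 (switching_graph H) (majority (edges ?G))"
      using majority_br_polymorphism E by metis
    then show ?wnu using majority_conservative nu3_wnu[OF majority_nu3] by blast
  qed
  \<comment> \<open>The WNU polymorphism serves to exclude asteroidal triples; the 3-NU polymorphism
    is again \<open>majority\<close>.\<close>
  show ?maj if ?wnu
  proof -
    have "\<not> asteroidal (edges ?G) a b c" for a b c
      using that wnu_not_asteroidal[OF G] unfolding V br_polymorphism_def by blast
    then have "polymorphism 3 ?G (majority (edges ?G))" using majority_polymorphism[OF G] by blast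
    then show ?maj using majority_conservative majority_nu3 by blast
  qed
qed

end
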